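(* Let $F$ be an analytic function on a domain $D\subset\mathbb{C}$, let $H$ be the mean curvature of the modular surface in $\mathbb{E}_1^3$ generated by $F$, and let $z_0\in D$ be a point with $|F'(z_0)|\neq1$. All quantities below are evaluated at $z_0$. (1) If $F\neq0$, $F'\neq0$, $F''\neq0$, then $H\geq0$, $H=0$, $H\leq0$ according as $\operatorname{Re}\left(\frac{FF''}{(F')^2}\right)$ is $\leq$, $=$, $\geq$ $1-\frac{1}{|F'|^2}$, respectively. (2) If $F\neq0$, $F'\neq0$, $F''=0$, then $H>0$ if $|F'|>1$, and $H<0$ if $|F'|<1$. (3) If $F\neq0$ and $F'=0$ (whether $F''\neq 0$ or $F''=0$), then $H=0$. (4) If $F=0$ and $F'\neq0$ (whether $F''\neq0$ or $F''=0$), then $H$ is undefined (the surface is not smooth at that point). (5) If $F=F'=F''=0$, then $H=0$.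
   Context: $\mathbb{E}_1^3$ denotes $\mathbb{R}^3$ with the Lorentzian metric $dx^2+dy^2-dt^2$; $(x,y)$ is identified with $z=x+iy$. The modular surface generated by an analytic function $F$ on $D$ is the graph $(x,y,h(x,y))$, $x+iy\in D$, with $h=|F|$; one has $h_x^2+h_y^2=|F'|^2$ where $F\ne0$. The mean curvature is $$H=-\frac{(1-h_y^2)h_{xx}+2h_xh_yh_{xy}+(1-h_x^2)h_{yy}}{2|1-h_x^2-h_y^2|^{3/2}}.$$ $F$ is not required to be the square of an analytic function. *)

theory Defs
  imports "HOL-Complex_Analysis.Complex_Analysis"
begin

definition partial_x :: "(complex \<Rightarrow> real) \<Rightarrow> complex \<Rightarrow> real" where
  "partial_x h z = deriv (\<lambda>x. h (Complex x (Im z))) (Re z)"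

definition partial_y :: "(complex \<Rightarrow> real) \<Rightarrow> complex \<Rightarrow> real" where
  "partial_y h z = deriv (\<lambda>y. h (Complex (Re z) y)) (Im z)"

text \<open>The differentiability clauses guarantee that the values of the (total) functions
  \<open>partial_x\<close> and \<open>partial_y\<close> occurring below are genuine partial derivatives.\<close>

definition C2_near :: "(complex \<Rightarrow> real) \<Rightarrow> complex \<Rightarrow> bool" where
  "C2_near h z \<longleftrightarrow> (\<exists>U. open U \<and> z \<in> U \<and>
     h differentiable_on U \<and>
     partial_x h differentiable_on U \<and>
     partial_y h differentiable_on U \<and>
     continuous_on U (partial_x (partial_x h)) \<and>
     continuous_on U (partial_y (partial_x h)) \<and>
     continuous_on U (partial_x (partial_y h)) \<and>
     continuous_on U (partial_y (partial_y h)))"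

text \<open>The graph \<open>t = h(x,y)\<close> in \<open>\<real>\<^sup>3\<close> with the metric \<open>dx\<^sup>2 + dy\<^sup>2 - dt\<^sup>2\<close> has a mean
  curvature at a point where it is a \<open>C\<^sup>2\<close> surface and its tangent plane is not lightlike.
  Outside this situation the value of \<open>lorentz_mean_curvature\<close> is meaningless.\<close>

definition lorentz_mean_curvature_defined :: "(complex \<Rightarrow> real) \<Rightarrow> complex \<Rightarrow> bool" where
  "lorentz_mean_curvature_defined h z \<longleftrightarrow>
     C2_near h z \<and> 1 - (partial_x h z)\<^sup>2 - (partial_y h z)\<^sup>2 \<noteq> 0"

definition lorentz_mean_curvature :: "(complex \<Rightarrow> real) \<Rightarrow> complex \<Rightarrow> real" where
  "lorentz_mean_curvature h z =
     - ((1 - (partial_y h z)\<^sup>2) * partial_x (partial_x h) z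
        + 2 * partial_x h z * partial_y h z * partial_y (partial_x h) z
        + (1 - (partial_x h z)\<^sup>2) * partial_y (partial_y h) z)
     / (2 * \<bar>1 - (partial_x h z)\<^sup>2 - (partial_y h z)\<^sup>2\<bar> powr (3/2))"

definition modular_height :: "(complex \<Rightarrow> complex) \<Rightarrow> complex \<Rightarrow> real" where
  "modular_height F z = cmod (F z)"

end

theory Submission
  imports Defs
begin

text \<open>
  Encode the gradient of a real function \<open>h\<close> on the plane by the complex number
  \<open>p = h\<^sub>x - \<i> h\<^sub>y\<close>, so that \<open>dh(d) = Re (p d)\<close>.  Where \<open>F \<noteq> 0\<close>, \<open>log \<bar>F\<bar>\<close> is the real part
  of a local branch of \<open>log F\<close>, and hence \<open>h = \<bar>F\<bar>\<close> has \<open>p = \<bar>F\<bar> w\<close> with the logarithmic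
  derivative \<open>w = F'/F\<close>.  Differentiating once more expresses all second partial derivatives
  of \<open>h\<close> through \<open>\<bar>F\<bar>\<close>, \<open>w\<close> and \<open>w' = F''/F - w\<^sup>2\<close>.  In particular
  \<open>h\<^sub>x\<^sup>2 + h\<^sub>y\<^sup>2 = \<bar>F'\<bar>\<^sup>2\<close>, and the numerator of the mean curvature collapses to
  \<open>\<bar>F\<bar> (\<bar>w\<bar>\<^sup>2 + \<bar>F\<bar>\<^sup>2 Re (w' cnj w\<^sup>2))\<close> (lemma \<open>numerator_identity\<close>).  It vanishes where
  \<open>F' = 0\<close>; elsewhere \<open>w'/w\<^sup>2 = F F''/F'\<^sup>2 - 1\<close> turns it into
  \<open>\<bar>F\<bar> \<bar>w\<bar>\<^sup>2 (1 + \<bar>F'\<bar>\<^sup>2 (Re (F F''/F'\<^sup>2) - 1))\<close>.  Its sign, opposite to that of the curvature, gives all the claims at points with \<open>F \<noteq> 0\<close>.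

  At a zero of \<open>F\<close> with \<open>F' \<noteq> 0\<close> the function \<open>h\<close> has a minimum, so a derivative would have to
  vanish there, whereas \<open>h\<close> grows linearly away from the zero.

  At a zero of order at least three (or inside the zero set) the surface is still \<open>C\<^sup>2\<close>.  The
  formulas for \<open>p\<close> and its derivative extend to the zero with value \<open>0\<close>, because
  \<open>\<bar>p\<bar> \<le> \<bar>F'\<bar>\<close> and the second derivatives are bounded by \<open>2 \<bar>F'\<^sup>2/F\<bar> + \<bar>F''\<bar>\<close>.  The
  quotient tends to \<open>0\<close>: it is the product of \<open>(z - z\<^sub>0) F'/F\<close>, which tends to the order of the
  zero, and \<open>F'/(z - z\<^sub>0)\<close>, which tends to \<open>F''(z\<^sub>0) = 0\<close>.
\<close>

section \<open>Partial derivatives from complex gradients\<close>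

lemma partial_of_has_derivative:
  assumes "(h has_derivative h') (at z)"
  shows "partial_x h z = h' 1" and "partial_y h z = h' \<i>"
proof -
  have lin: "linear h'"
    using assms by (rule has_derivative_linear)
  have cx: "((\<lambda>x. Complex x (Im z)) has_derivative (\<lambda>t. of_real t)) (at (Re z))"
    unfolding Complex_eq by (auto intro!: derivative_eq_intros)
  have cy: "((\<lambda>y. Complex (Re z) y) has_derivative (\<lambda>t. \<i> * of_real t)) (at (Im z))"
    unfolding Complex_eq by (auto intro!: derivative_eq_intros)
  have "((\<lambda>x. h (Complex x (Im z))) has_derivative (\<lambda>t. h' (of_real t))) (at (Re z))"
    using has_derivative_compose[OF cx] assms by simp
  moreover have "h' (of_real t) = h' 1 * t" for t
    using linear_scale[OF lin, of t 1] by (simp add: scaleR_conv_of_real mult.commute)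
  ultimately have "((\<lambda>x. h (Complex x (Im z))) has_field_derivative h' 1) (at (Re z))"
    by (simp add: has_field_derivative_def)
  then show "partial_x h z = h' 1"
    unfolding partial_x_def by (rule DERIV_imp_deriv)
  have "((\<lambda>y. h (Complex (Re z) y)) has_derivative (\<lambda>t. h' (\<i> * of_real t))) (at (Im z))"
    using has_derivative_compose[OF cy] assms by simp
  moreover have "h' (\<i> * of_real t) = h' \<i> * t" for t
    using linear_scale[OF lin, of t \<i>] by (simp add: scaleR_conv_of_real mult.commute)
  ultimately have "((\<lambda>y. h (Complex (Re z) y)) has_field_derivative h' \<i>) (at (Im z))"
    by (simp add: has_field_derivative_def)
  then show "partial_y h z = h' \<i>"
    unfolding partial_y_def by (rule DERIV_imp_deriv)
qed

lemma partials_of_complex_gradient: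
  assumes "open U"
    and h: "\<forall>z\<in>U. (h has_derivative (\<lambda>d. Re (p z * d))) (at z)"
    and p: "\<forall>z\<in>U. (p has_derivative P z) (at z)"
    and "z \<in> U"
  shows "partial_x h z = Re (p z)" and "partial_y h z = - Im (p z)"
    and "(partial_x h has_derivative (\<lambda>d. Re (P z d))) (at z)"
    and "(partial_y h has_derivative (\<lambda>d. - Im (P z d))) (at z)"
    and "partial_x (partial_x h) z = Re (P z 1)"
    and "partial_y (partial_x h) z = Re (P z \<i>)"
    and "partial_x (partial_y h) z = - Im (P z 1)"
    and "partial_y (partial_y h) z = - Im (P z \<i>)"
proof -
  have x: "partial_x h w = Re (p w)" and y: "partial_y h w = - Im (p w)" if "w \<in> U" for w
    using partial_of_has_derivative[OF bspec[OF h that]] by simp_all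
  show "partial_x h z = Re (p z)" "partial_y h z = - Im (p z)"
    using x y \<open>z \<in> U\<close> by auto
  have "((\<lambda>w. Re (p w)) has_derivative (\<lambda>d. Re (P z d))) (at z)"
    using bspec[OF p \<open>z \<in> U\<close>] by (rule has_derivative_Re)
  then show dx: "(partial_x h has_derivative (\<lambda>d. Re (P z d))) (at z)"
    by (rule has_derivative_transform_within_open) (use assms x in auto)
  have "((\<lambda>w. - Im (p w)) has_derivative (\<lambda>d. - Im (P z d))) (at z)"
    using bspec[OF p \<open>z \<in> U\<close>] by (intro has_derivative_minus has_derivative_Im)
  then show dy: "(partial_y h has_derivative (\<lambda>d. - Im (P z d))) (at z)"
    by (rule has_derivative_transform_within_open) (use assms y in auto)
  show "partial_x (partial_x h) z = Re (P z 1)" "partial_y (partial_x h) z = Re (P z \<i>)"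
    using partial_of_has_derivative[OF dx] by simp_all
  show "partial_x (partial_y h) z = - Im (P z 1)" "partial_y (partial_y h) z = - Im (P z \<i>)"
    using partial_of_has_derivative[OF dy] by simp_all
qed

lemma C2_near_of_complex_gradient:
  assumes "open U" and "z \<in> U"
    and h: "\<forall>z\<in>U. (h has_derivative (\<lambda>d. Re (p z * d))) (at z)"
    and p: "\<forall>z\<in>U. (p has_derivative P z) (at z)"
    and c1: "continuous_on U (\<lambda>z. P z 1)" and ci: "continuous_on U (\<lambda>z. P z \<i>)"
  shows "C2_near h z"
proof -
  note part = partials_of_complex_gradient[OF \<open>open U\<close> h p]
  have "h differentiable_on U" "partial_x h differentiable_on U" "partial_y h differentiable_on U"
    using h part(3,4) by (meson differentiableI differentiable_at_imp_differentiable_on)+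
  moreover have "continuous_on U (partial_x (partial_x h))"
    "continuous_on U (partial_y (partial_x h))"
    "continuous_on U (partial_x (partial_y h))"
    "continuous_on U (partial_y (partial_y h))"
    using c1 ci
    by (simp_all add: part cong: continuous_on_cong_simp)
       (intro continuous_intros; simp)+
  ultimately show ?thesis
    unfolding C2_near_def using assms(1,2) by blast
qed

section \<open>Gradient and Hessian of the modulus of a holomorphic function\<close>

text \<open>Division by zero gives both definitions the value \<open>0\<close> at zeros of \<open>F\<close>, which is the
  continuous extension at zeros of order at least three.\<close>

definition modular_grad :: "(complex \<Rightarrow> complex) \<Rightarrow> complex \<Rightarrow> complex" where
  "modular_grad F z = of_real (cmod (F z)) * (deriv F z / F z)"

definition modular_hess :: "(complex \<Rightarrow> complex) \<Rightarrow> complex \<Rightarrow> complex \<Rightarrow> complex" where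
  "modular_hess F z d =
     of_real (Re (modular_grad F z * d)) * (deriv F z / F z)
     + of_real (cmod (F z)) * ((deriv (deriv F) z / F z - (deriv F z / F z)\<^sup>2) * d)"

lemma modular_height_has_derivative:
  assumes "F holomorphic_on S" "open S" "z \<in> S" "F z \<noteq> 0"
  shows "(modular_height F has_derivative (\<lambda>d. Re (modular_grad F z * d))) (at z)"
proof -
  have F: "(F has_derivative (\<lambda>d. deriv F z * d)) (at z)"
    using holomorphic_derivI[OF assms(1-3), of UNIV] by (simp add: has_field_derivative_def)
  have "((\<lambda>w. norm (F w)) has_derivative (\<lambda>d. inner (deriv F z * d) (sgn (F z)))) (at z)"
    using has_derivative_compose[OF F has_derivative_norm[OF assms(4)]] by simp
  moreover have "inner (deriv F z * d) (sgn (F z)) = Re (modular_grad F z * d)" for d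
  proof -
    have "of_real (cmod (F z)) / F z = cnj (sgn (F z))"
      using assms(4) complex_norm_square[of "F z"]
      by (simp add: sgn_eq field_simps power2_eq_square)
    moreover have "modular_grad F z * d = (of_real (cmod (F z)) / F z) * (deriv F z * d)"
      by (simp add: modular_grad_def)
    ultimately have grad: "modular_grad F z * d = cnj (sgn (F z)) * (deriv F z * d)"
      by (simp only:)
    have "inner u v = Re (cnj v * u)" for u v :: complex
      by (simp add: inner_complex_def algebra_simps)
    then show ?thesis
      by (simp only: grad)
  qed
  ultimately show ?thesis
    by (simp add: modular_height_def[abs_def])
qed

lemma modular_grad_has_derivative:
  assumes "F holomorphic_on S" "open S" "z \<in> S" "F z \<noteq> 0"
  shows "(modular_grad F has_derivative modular_hess F z) (at z)"
proof -
  have F: "(F has_field_derivative deriv F z) (at z)"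
    using holomorphic_derivI[OF assms(1-3)] .
  have F': "(deriv F has_field_derivative deriv (deriv F) z) (at z)"
    using holomorphic_derivI[OF holomorphic_deriv[OF assms(1,2)] assms(2,3)] .
  have "((\<lambda>w. deriv F w / F w) has_field_derivative
          (deriv (deriv F) z / F z - (deriv F z / F z)\<^sup>2)) (at z)"
    by (rule derivative_eq_intros F F' assms(4) refl)+
       (use assms(4) in \<open>simp add: field_simps power2_eq_square\<close>)
  then have w: "((\<lambda>w. deriv F w / F w) has_derivative
          (\<lambda>d. (deriv (deriv F) z / F z - (deriv F z / F z)\<^sup>2) * d)) (at z)"
    by (simp add: has_field_derivative_def)
  have h: "((\<lambda>w. complex_of_real (cmod (F w))) has_derivative
          (\<lambda>d. of_real (Re (modular_grad F z * d)))) (at z)"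
    using has_derivative_of_real[OF modular_height_has_derivative[OF assms]]
    by (simp add: modular_height_def)
  show ?thesis
    using has_derivative_mult[OF h w]
    by (simp add: modular_grad_def[of F, abs_def] modular_hess_def[of F, abs_def] add.commute)
qed

lemma continuous_on_modular_hess:
  assumes "F holomorphic_on S" "open S" "\<And>z. z \<in> S \<Longrightarrow> F z \<noteq> 0"
  shows "continuous_on S (\<lambda>z. modular_hess F z d)"
proof -
  have "continuous_on S F" "continuous_on S (deriv F)" "continuous_on S (deriv (deriv F))"
    using assms(1,2) by (meson holomorphic_deriv holomorphic_on_imp_continuous_on)+
  then show ?thesis
    unfolding modular_hess_def modular_grad_def using assms(3)
    by (intro continuous_intros) auto
qed

lemma cmod_modular_grad:
  "F z \<noteq> 0 \<Longrightarrow> cmod (modular_grad F z) = cmod (deriv F z)"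
  by (simp add: modular_grad_def norm_mult norm_divide)

lemma cmod_modular_grad_le:
  "cmod (modular_grad F z) \<le> cmod (deriv F z)"
  by (cases "F z = 0") (auto simp: cmod_modular_grad, simp add: modular_grad_def)

lemma cmod_modular_hess_le:
  assumes "cmod d = 1"
  shows "cmod (modular_hess F z d)
    \<le> 2 * cmod ((deriv F z)\<^sup>2 / F z) + cmod (deriv (deriv F) z)"
proof (cases "F z = 0")
  case True
  then show ?thesis by (simp add: modular_hess_def)
next
  case False
  let ?w = "deriv F z / F z"
  let ?w' = "deriv (deriv F) z / F z - ?w\<^sup>2"
  have "\<bar>Re (modular_grad F z * d)\<bar> \<le> cmod (modular_grad F z)"
    using abs_Re_le_cmod[of "modular_grad F z * d"] assms by (simp add: norm_mult)
  then have "cmod (of_real (Re (modular_grad F z * d)) * ?w) \<le> cmod (deriv F z) * cmod ?w"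
    using False unfolding norm_mult norm_of_real
    by (intro mult_right_mono) (simp_all only: cmod_modular_grad[of F z, OF False] norm_ge_zero)
  also have "\<dots> = cmod ((deriv F z)\<^sup>2 / F z)"
    by (simp add: norm_divide norm_mult power2_eq_square)
  finally have 1: "cmod (of_real (Re (modular_grad F z * d)) * ?w) \<le> cmod ((deriv F z)\<^sup>2 / F z)" .
  have "cmod (of_real (cmod (F z)) * (?w' * d)) = cmod (F z * ?w')"
    using assms by (simp add: norm_mult)
  also have "F z * ?w' = deriv (deriv F) z - (deriv F z)\<^sup>2 / F z"
    using False by (simp add: field_simps power2_eq_square)
  also have "cmod \<dots> \<le> cmod (deriv (deriv F) z) + cmod ((deriv F z)\<^sup>2 / F z)"
    by (rule norm_triangle_ineq4)
  finally have 2: "cmod (of_real (cmod (F z)) * (?w' * d))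
      \<le> cmod (deriv (deriv F) z) + cmod ((deriv F z)\<^sup>2 / F z)" .
  show ?thesis
    unfolding modular_hess_def using norm_triangle_mono[OF 1 2] by simp
qed

section \<open>The mean curvature away from zeros\<close>

text \<open>Here \<open>m\<close>, \<open>w\<close>, \<open>v\<close> play the roles of \<open>\<bar>F\<bar>\<close>, \<open>F'/F\<close> and the derivative of \<open>F'/F\<close>.
  The left-hand side is the Laplacian \<open>m \<bar>w\<bar>\<^sup>2\<close>, in which \<open>v\<close> cancels, minus
  \<open>h\<^sub>y\<^sup>2 h\<^sub>x\<^sub>x - 2 h\<^sub>x h\<^sub>y h\<^sub>x\<^sub>y + h\<^sub>x\<^sup>2 h\<^sub>y\<^sub>y\<close>, the Hessian form on the vector \<open>(h\<^sub>y, - h\<^sub>x)\<close> along the level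
  line, to which only \<open>v\<close> contributes.\<close>

lemma numerator_identity:
  fixes m :: real and w v :: complex
  defines "p \<equiv> of_real m * w"
    and "P \<equiv> \<lambda>d. of_real (Re (of_real m * w * d)) * w + of_real m * (v * d)"
  shows "(1 - (- Im p)\<^sup>2) * Re (P 1) + 2 * Re p * (- Im p) * Re (P \<i>) + (1 - (Re p)\<^sup>2) * (- Im (P \<i>))
    = m * ((cmod w)\<^sup>2 + m\<^sup>2 * Re (v * (cnj w)\<^sup>2))"
  unfolding p_def P_def cmod_power2
  by (simp add: power2_eq_square algebra_simps)

lemma
  assumes "F holomorphic_on D" "open D" "z \<in> D" "F z \<noteq> 0" "cmod (deriv F z) \<noteq> 1"
  shows lorentz_mean_curvature_defined_nonzero:
      "lorentz_mean_curvature_defined (modular_height F) z"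
    and lorentz_mean_curvature_nonzero:
      "lorentz_mean_curvature (modular_height F) z =
        - ((cmod (deriv F z))\<^sup>2 / cmod (F z)
             * (1 + (cmod (deriv F z))\<^sup>2 * (Re (F z * deriv (deriv F) z / (deriv F z)\<^sup>2) - 1)))
        / (2 * \<bar>1 - (cmod (deriv F z))\<^sup>2\<bar> powr (3/2))"
proof -
  let ?U = "D - {z. F z = 0}"
  have U: "open ?U"
  proof -
    have "?U = D \<inter> F -` (- {0})" by auto
    moreover have "open (D \<inter> F -` (- {0}))"
      using assms(1,2) by (intro continuous_open_preimage holomorphic_on_imp_continuous_on) auto
    ultimately show ?thesis by simp
  qed
  have zU: "z \<in> ?U" using assms by simp
  have hd: "\<forall>w\<in>?U. (modular_height F has_derivative (\<lambda>d. Re (modular_grad F w * d))) (at w)"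
    and pd: "\<forall>w\<in>?U. (modular_grad F has_derivative modular_hess F w) (at w)"
    using assms modular_height_has_derivative modular_grad_has_derivative by blast+
  have C2: "C2_near (modular_height F) z"
    using assms(1)
    by (intro C2_near_of_complex_gradient[OF U zU hd pd] continuous_on_modular_hess U)
       (auto intro: holomorphic_on_subset)
  note part = partials_of_complex_gradient[OF U hd pd zU]
  have denom: "1 - (partial_x (modular_height F) z)\<^sup>2 - (partial_y (modular_height F) z)\<^sup>2
      = 1 - (cmod (deriv F z))\<^sup>2"
    unfolding cmod_modular_grad[of F z, OF assms(4), symmetric] cmod_power2 part by simp
  show "lorentz_mean_curvature_defined (modular_height F) z"
    using C2 assms(5) by (simp add: lorentz_mean_curvature_defined_def denom power2_eq_1_iff)
       (use norm_ge_zero[of "deriv F z"] in linarith)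
  let ?w = "deriv F z / F z"
  let ?v = "deriv (deriv F) z / F z - ?w\<^sup>2"
  let ?Q = "F z * deriv (deriv F) z / (deriv F z)\<^sup>2"
  have v: "Re (?v * (cnj ?w)\<^sup>2) = (cmod ?w)^4 * (Re ?Q - 1)"
  proof (cases "deriv F z = 0")
    case False
    have "?v = ?w\<^sup>2 * (?Q - 1)"
      using False assms(4) by (simp add: field_simps power2_eq_square)
    then have "?v * (cnj ?w)\<^sup>2 = (?w * cnj ?w)\<^sup>2 * (?Q - 1)"
      by (simp only: power_mult_distrib mult_ac)
    also have "\<dots> = of_real ((cmod ?w)^4) * (?Q - 1)"
      by (simp only: complex_norm_square[symmetric] of_real_power[symmetric]) 
        (simp flip: power_mult)
    finally have eq: "?v * (cnj ?w)\<^sup>2 = of_real ((cmod ?w)^4) * (?Q - 1)" .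
    have "Re (of_real x * y) = x * Re y" for x y
      by simp
    then show ?thesis
      by (simp only: eq minus_complex.sel one_complex.sel)
  qed simp
  have "(1 - (partial_y (modular_height F) z)\<^sup>2) * partial_x (partial_x (modular_height F)) z
        + 2 * partial_x (modular_height F) z * partial_y (modular_height F) z
            * partial_y (partial_x (modular_height F)) z
        + (1 - (partial_x (modular_height F) z)\<^sup>2) * partial_y (partial_y (modular_height F)) z
      = cmod (F z) * ((cmod ?w)\<^sup>2 + (cmod (F z))\<^sup>2 * Re (?v * (cnj ?w)\<^sup>2))"
    unfolding part modular_hess_def modular_grad_def by (rule numerator_identity)
  also have "\<dots> = (cmod (deriv F z))\<^sup>2 / cmod (F z) * (1 + (cmod (deriv F z))\<^sup>2 * (Re ?Q - 1))"
    unfolding v using assms(4)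
    by (simp add: norm_divide field_simps power2_eq_square power4_eq_xxxx)
  finally show "lorentz_mean_curvature (modular_height F) z =
        - ((cmod (deriv F z))\<^sup>2 / cmod (F z) * (1 + (cmod (deriv F z))\<^sup>2 * (Re ?Q - 1)))
        / (2 * \<bar>1 - (cmod (deriv F z))\<^sup>2\<bar> powr (3/2))"
    unfolding lorentz_mean_curvature_def denom by simp
qed

section \<open>Zeros of the function\<close>

lemma not_differentiable_at_simple_zero:
  assumes "(F has_field_derivative F') (at z)" "F z = 0" "F' \<noteq> 0"
  shows "\<not> modular_height F differentiable (at z)"
proof
  assume "modular_height F differentiable (at z)"
  then obtain h' where h': "(modular_height F has_derivative h') (at z)"
    by (auto simp: differentiable_def)
  have "h' = (\<lambda>v. 0)"
    by (rule differential_zero_maxmin[OF UNIV_I open_UNIV h'])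
       (simp add: modular_height_def assms(2))
  then have "((\<lambda>y. norm (modular_height F y - modular_height F z) / norm (y - z)) \<longlongrightarrow> 0) (at z)"
    using h' by (simp add: has_derivative_iff_norm)
  then have "((\<lambda>y. norm ((F y - F z) / (y - z))) \<longlongrightarrow> 0) (at z)"
    by (simp add: modular_height_def assms(2) norm_divide)
  moreover have "((\<lambda>y. norm ((F y - F z) / (y - z))) \<longlongrightarrow> norm F') (at z)"
    using assms(1) by (intro tendsto_norm) (simp add: has_field_derivative_iff)
  ultimately have "norm F' = 0"
    using tendsto_unique[of "at z"] by (metis at_neq_bot)
  then show False using assms(3) by simp
qed

lemma has_derivative_zero_dominated:
  fixes g :: "'a::real_normed_vector \<Rightarrow> 'b::real_normed_vector"
    and f :: "'a \<Rightarrow> 'c::real_normed_vector"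
  assumes "(f has_derivative (\<lambda>_. 0)) (at z)" "f z = 0" "\<And>w. norm (g w) \<le> norm (f w)"
  shows "(g has_derivative (\<lambda>_. 0)) (at z)"
proof -
  have "g z = 0" using assms(2) assms(3)[of z] by simp
  have "((\<lambda>y. norm (f y) / norm (y - z)) \<longlongrightarrow> 0) (at z)"
    using assms(1,2) by (simp add: has_derivative_iff_norm)
  then have "((\<lambda>y. norm (g y) / norm (y - z)) \<longlongrightarrow> 0) (at z)"
    by (rule Lim_null_comparison[rotated])
       (auto intro!: always_eventually divide_right_mono assms(3))
  then show ?thesis
    using \<open>g z = 0\<close> by (simp add: has_derivative_iff_norm)
qed

text \<open>Write \<open>F = (z - z\<^sub>0)\<^sup>n g\<close> with \<open>g(z\<^sub>0) \<noteq> 0\<close>; then \<open>(z - z\<^sub>0) F'/F = n + (z - z\<^sub>0) g'/g\<close> stays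
  bounded, while \<open>F'/(z - z\<^sub>0)\<close> tends to \<open>F''(z\<^sub>0) = 0\<close>.\<close>

lemma deriv_squared_over_self_tendsto_0:
  assumes r: "r > 0" and g: "g holomorphic_on ball z0 r" "\<And>z. z \<in> ball z0 r \<Longrightarrow> g z \<noteq> 0"
    and F: "F holomorphic_on ball z0 r" "\<And>z. z \<in> ball z0 r \<Longrightarrow> F z = (z - z0) ^ n * g z"
    and "deriv F z0 = 0" "deriv (deriv F) z0 = 0"
  shows "((\<lambda>z. (deriv F z)\<^sup>2 / F z) \<longlongrightarrow> 0) (at z0)"
proof -
  let ?B = "ball z0 r"
  have z0: "z0 \<in> ?B" using r by simp
  have dF: "(z - z0) * deriv F z = (of_nat n * g z + (z - z0) * deriv g z) * (z - z0) ^ n"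
    if "z \<in> ?B" for z
  proof -
    have "((\<lambda>z. (z - z0) ^ n * g z) has_field_derivative
        of_nat n * (z - z0) ^ (n - 1) * g z + (z - z0) ^ n * deriv g z) (at z)"
      by (auto intro!: derivative_eq_intros holomorphic_derivI[OF g(1) open_ball that])
    then have "(F has_field_derivative
        of_nat n * (z - z0) ^ (n - 1) * g z + (z - z0) ^ n * deriv g z) (at z)"
      by (rule has_field_derivative_transform_within_open[OF _ open_ball that]) (simp add: F(2))
    then have "deriv F z = of_nat n * (z - z0) ^ (n - 1) * g z + (z - z0) ^ n * deriv g z"
      by (rule DERIV_imp_deriv)
    then show ?thesis
      by (simp only:) (cases n; simp add: algebra_simps)
  qed
  have cont: "isCont g z0" "isCont (deriv g) z0"
    using g(1) z0 by (meson continuous_on_eq_continuous_at holomorphic_deriv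
        holomorphic_on_imp_continuous_on open_ball)+
  have "((\<lambda>z. of_nat n + (z - z0) * deriv g z / g z)
      \<longlongrightarrow> of_nat n + (z0 - z0) * deriv g z0 / g z0) (at z0)"
    using cont g(2)[OF z0] by (intro tendsto_intros) (auto simp: isCont_def)
  moreover have "((\<lambda>z. (deriv F z - deriv F z0) / (z - z0)) \<longlongrightarrow> deriv (deriv F) z0) (at z0)"
    using holomorphic_derivI[OF holomorphic_deriv[OF F(1) open_ball] open_ball z0]
    by (simp add: has_field_derivative_iff)
  ultimately have "((\<lambda>z. (of_nat n + (z - z0) * deriv g z / g z) * (deriv F z / (z - z0)))
      \<longlongrightarrow> 0) (at z0)"
    using assms(6,7) tendsto_mult by fastforce
  moreover have "\<forall>\<^sub>F z in at z0. (of_nat n + (z - z0) * deriv g z / g z) * (deriv F z / (z - z0))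
      = (deriv F z)\<^sup>2 / F z"
    using eventually_at_in_open[OF open_ball z0]
  proof eventually_elim
    case (elim z)
    then have z: "z \<in> ?B" "z \<noteq> z0" by auto
    have "of_nat n + (z - z0) * deriv g z / g z = (z - z0) * deriv F z / F z"
      unfolding dF[OF z(1)] F(2)[OF z(1)] using g(2)[OF z(1)] z(2) by (simp add: field_simps)
    then show ?case using z(2) by (simp add: power2_eq_square)
  qed
  ultimately show ?thesis by (rule Lim_transform_eventually)
qed

lemma
  assumes "F holomorphic_on D" "open D" "z0 \<in> D"
    and zero: "F z0 = 0" "deriv F z0 = 0" "deriv (deriv F) z0 = 0"
  shows lorentz_mean_curvature_defined_triple_zero:
      "lorentz_mean_curvature_defined (modular_height F) z0"
    and lorentz_mean_curvature_triple_zero: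
      "lorentz_mean_curvature (modular_height F) z0 = 0"
proof -
  obtain s where s: "s > 0" "ball z0 s \<subseteq> D"
    using assms(2,3) openE by blast
  have hol_s: "F holomorphic_on ball z0 s"
    using assms(1) s(2) by (rule holomorphic_on_subset)
  \<comment> \<open>Zeros of a holomorphic function are isolated unless it vanishes identically nearby; in the
    latter case the quotient is \<open>0\<close> because division by zero yields \<open>0\<close>.\<close>
  obtain r where r: "r > 0" "ball z0 r \<subseteq> D"
    and iso: "(\<forall>z\<in>ball z0 r. F z = 0) \<or> (\<forall>z\<in>ball z0 r - {z0}. F z \<noteq> 0)"
    and lim: "((\<lambda>z. (deriv F z)\<^sup>2 / F z) \<longlongrightarrow> 0) (at z0)"
  proof (cases "F constant_on ball z0 s")
    case True
    then have 0: "F z = 0" if "z \<in> ball z0 s" for z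
      using that zero(1) s(1) by (metis centre_in_ball constant_on_def)
    have "\<forall>\<^sub>F z in at z0. (deriv F z)\<^sup>2 / F z = 0"
      using eventually_at_in_open[OF open_ball, of z0 z0 s] s(1)
      by (auto elim!: eventually_mono simp: 0)
    then have "((\<lambda>z. (deriv F z)\<^sup>2 / F z) \<longlongrightarrow> 0) (at z0)"
      by (rule tendsto_eventually)
    with 0 s that show ?thesis by blast
  next
    case False
    have "z0 \<in> ball z0 s" using s(1) by simp
    from holomorphic_factor_zero_nonconstant
      [OF hol_s open_ball connected_ball this zero(1) False]
    obtain g r n where n: "0 < n" and r: "0 < r" "ball z0 r \<subseteq> ball z0 s"
      and g: "g holomorphic_on ball z0 r"
        "\<And>w. w \<in> ball z0 r \<Longrightarrow> F w = (w - z0) ^ n * g w"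
        "\<And>w. w \<in> ball z0 r \<Longrightarrow> g w \<noteq> 0"
      by metis
    have "((\<lambda>z. (deriv F z)\<^sup>2 / F z) \<longlongrightarrow> 0) (at z0)"
      using hol_s r(2) by (intro deriv_squared_over_self_tendsto_0[OF r(1) g(1,3) _ g(2) zero(2,3)])
         (auto intro: holomorphic_on_subset)
    moreover have "\<forall>z\<in>ball z0 r - {z0}. F z \<noteq> 0"
      using g(2,3) by simp
    ultimately show ?thesis using that r s by blast
  qed
  let ?U = "ball z0 r"
  have z0U: "z0 \<in> ?U" using r by simp
  have hol: "F holomorphic_on ?U"
    using assms(1) r(2) by (rule holomorphic_on_subset)
  have F: "(F has_field_derivative deriv F z) (at z)"
    and F': "(deriv F has_field_derivative deriv (deriv F) z) (at z)" if "z \<in> ?U" for z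
    using that hol by (auto intro!: holomorphic_derivI holomorphic_deriv)
  have zero_case: "deriv F z = 0 \<and> deriv (deriv F) z = 0" if z: "z \<in> ?U" "F z = 0" for z
  proof (cases "z = z0")
    case False
    then have 0: "\<forall>z\<in>?U. F z = 0" using iso z by auto
    have "deriv F w = 0" if "w \<in> ?U" for w
      by (rule DERIV_unique[OF F[OF that]])
         (rule has_field_derivative_transform_within_open[OF DERIV_const open_ball that], simp add: 0)
    moreover from this have "deriv (deriv F) z = 0"
      by (intro DERIV_unique[OF F'[OF z(1)]]
            has_field_derivative_transform_within_open[OF DERIV_const open_ball z(1)]) simp
    ultimately show ?thesis using z by blast
  qed (simp add: zero)
  \<comment> \<open>At a zero all of \<open>F\<close>, \<open>F'\<close>, \<open>F''\<close> vanish, so gradient and Hessian vanish by comparison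
    with \<open>F\<close> and \<open>F'\<close>.\<close>
  have hd: "\<forall>z\<in>?U. (modular_height F has_derivative (\<lambda>d. Re (modular_grad F z * d))) (at z)"
  proof
    fix z assume z: "z \<in> ?U"
    show "(modular_height F has_derivative (\<lambda>d. Re (modular_grad F z * d))) (at z)"
    proof (cases "F z = 0")
      case True
      then have "(F has_derivative (\<lambda>_. 0)) (at z)"
        using F[OF z] zero_case[OF z] by (simp add: has_field_derivative_def lambda_zero)
      then have "(modular_height F has_derivative (\<lambda>_. 0)) (at z)"
        by (rule has_derivative_zero_dominated) (simp_all add: True modular_height_def)
      then show ?thesis by (simp add: modular_grad_def True)
    qed (use modular_height_has_derivative[OF hol open_ball z] in auto)
  qed
  have pd: "\<forall>z\<in>?U. (modular_grad F has_derivative modular_hess F z) (at z)"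
  proof
    fix z assume z: "z \<in> ?U"
    show "(modular_grad F has_derivative modular_hess F z) (at z)"
    proof (cases "F z = 0")
      case True
      then have "(deriv F has_derivative (\<lambda>_. 0)) (at z)"
        using F'[OF z] zero_case[OF z] by (simp add: has_field_derivative_def lambda_zero)
      then have "(modular_grad F has_derivative (\<lambda>_. 0)) (at z)"
        by (rule has_derivative_zero_dominated)
           (use zero_case[OF z True] in \<open>simp_all add: cmod_modular_grad_le\<close>)
      moreover have "modular_hess F z = (\<lambda>_. 0)"
        by (simp add: fun_eq_iff modular_hess_def True)
      ultimately show ?thesis by simp
    qed (use modular_grad_has_derivative[OF hol open_ball z] in auto)
  qed
  have cont: "continuous_on ?U (\<lambda>z. modular_hess F z d)" if d: "cmod d = 1" for d
    using iso
  proof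
    assume "\<forall>z\<in>?U. F z = 0"
    then have "continuous_on ?U (\<lambda>z. modular_hess F z d) = continuous_on ?U (\<lambda>z. 0::complex)"
      by (intro continuous_on_cong) (auto simp: modular_hess_def)
    then show ?thesis by simp
  next
    assume nz: "\<forall>z\<in>?U - {z0}. F z \<noteq> 0"
    have "isCont (\<lambda>z. modular_hess F z d) z" if z: "z \<in> ?U" for z
    proof (cases "z = z0")
      case True
      have "isCont (deriv (deriv F)) z0"
        using hol z0U by (meson continuous_on_eq_continuous_at holomorphic_deriv
            holomorphic_on_imp_continuous_on open_ball)
      then have "(deriv (deriv F) \<longlongrightarrow> 0) (at z0)"
        by (simp add: isCont_def zero)
      with lim have "((\<lambda>z. 2 * cmod ((deriv F z)\<^sup>2 / F z) + cmod (deriv (deriv F) z))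
          \<longlongrightarrow> 2 * cmod 0 + cmod 0) (at z0)"
        by (intro tendsto_intros)
      then have "((\<lambda>z. 2 * cmod ((deriv F z)\<^sup>2 / F z) + cmod (deriv (deriv F) z)) \<longlongrightarrow> 0) (at z0)"
        by simp
      then have "((\<lambda>z. modular_hess F z d) \<longlongrightarrow> 0) (at z0)"
        by (rule Lim_null_comparison[rotated])
           (intro always_eventually allI cmod_modular_hess_le d)
      moreover have "modular_hess F z0 d = 0" by (simp add: modular_hess_def zero)
      ultimately show ?thesis by (simp add: isCont_def True)
    next
      case False
      have "continuous_on (?U - {z0}) (\<lambda>z. modular_hess F z d)"
        using hol nz by (intro continuous_on_modular_hess) (auto intro: holomorphic_on_subset)
      then show ?thesis
        using z False by (simp add: continuous_on_eq_continuous_at open_delete)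
    qed
    then show ?thesis by (simp add: continuous_at_imp_continuous_on)
  qed
  have "C2_near (modular_height F) z0"
    by (intro C2_near_of_complex_gradient[OF open_ball z0U hd pd] cont) simp_all
  moreover note part = partials_of_complex_gradient[OF open_ball hd pd z0U]
  ultimately show "lorentz_mean_curvature_defined (modular_height F) z0"
    by (simp add: lorentz_mean_curvature_defined_def part modular_grad_def zero)
  show "lorentz_mean_curvature (modular_height F) z0 = 0"
    by (simp add: lorentz_mean_curvature_def part modular_hess_def zero)
qed

section \<open>The classification\<close>

theorem mainTheorem14:
  fixes F F' F'' :: "complex \<Rightarrow> complex" and D :: "complex set" and z0 :: complex
    and h :: "complex \<Rightarrow> real" and H :: real
  assumes "open D" and "connected D" and "F analytic_on D" and "z0 \<in> D"
    and "F' = deriv F" and "F'' = deriv (deriv F)"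
    and "h = modular_height F" and "H = lorentz_mean_curvature h z0"
    and "cmod (F' z0) \<noteq> 1"
  shows
    "(F z0 \<noteq> 0 \<and> F' z0 \<noteq> 0 \<and> F'' z0 \<noteq> 0 \<longrightarrow>
        lorentz_mean_curvature_defined h z0 \<and>
        (H \<ge> 0 \<longleftrightarrow> Re (F z0 * F'' z0 / (F' z0)\<^sup>2) \<le> 1 - 1 / (cmod (F' z0))\<^sup>2) \<and>
        (H = 0 \<longleftrightarrow> Re (F z0 * F'' z0 / (F' z0)\<^sup>2) = 1 - 1 / (cmod (F' z0))\<^sup>2) \<and>
        (H \<le> 0 \<longleftrightarrow> Re (F z0 * F'' z0 / (F' z0)\<^sup>2) \<ge> 1 - 1 / (cmod (F' z0))\<^sup>2)) \<and>
     (F z0 \<noteq> 0 \<and> F' z0 \<noteq> 0 \<and> F'' z0 = 0 \<longrightarrow>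
        lorentz_mean_curvature_defined h z0 \<and>
        (cmod (F' z0) > 1 \<longrightarrow> H > 0) \<and>
        (cmod (F' z0) < 1 \<longrightarrow> H < 0)) \<and>
     (F z0 \<noteq> 0 \<and> F' z0 = 0 \<longrightarrow>
        lorentz_mean_curvature_defined h z0 \<and> H = 0) \<and>
     (F z0 = 0 \<and> F' z0 \<noteq> 0 \<longrightarrow>
        \<not> lorentz_mean_curvature_defined h z0 \<and> \<not> h differentiable (at z0)) \<and>
     (F z0 = 0 \<and> F' z0 = 0 \<and> F'' z0 = 0 \<longrightarrow>
        lorentz_mean_curvature_defined h z0 \<and> H = 0)"
proof -
  have hol: "F holomorphic_on D"
    using assms(1,3) by (simp add: analytic_on_open)
  have eqs: "h = modular_height F" "F' = deriv F" "F'' = deriv (deriv F)" using assms by auto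
  define a where "a = cmod (F' z0)"
  define q where "q = Re (F z0 * F'' z0 / (F' z0)\<^sup>2)"
  have a: "a \<ge> 0" "a\<^sup>2 \<noteq> 1"
    using assms(9) by (auto simp: a_def power2_eq_1_iff) (smt (verit) norm_ge_zero)
  have defd: "lorentz_mean_curvature_defined h z0" if "F z0 \<noteq> 0"
    using lorentz_mean_curvature_defined_nonzero[OF hol assms(1,4) that] assms(9)
    by (simp add: eqs)
  define c where "c = 1 / (cmod (F z0) * (2 * \<bar>1 - a\<^sup>2\<bar> powr (3/2)))"
  have c: "c > 0" if "F z0 \<noteq> 0"
    unfolding c_def using that a(2) by auto
  have H: "H = c * a\<^sup>2 * (a\<^sup>2 * (1 - q) - 1)" if "F z0 \<noteq> 0"
  proof -
    have "H = - (a\<^sup>2 / cmod (F z0) * (1 + a\<^sup>2 * (q - 1))) / (2 * \<bar>1 - a\<^sup>2\<bar> powr (3/2))"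
      using lorentz_mean_curvature_nonzero[OF hol assms(1,4) that assms(9)[unfolded eqs]]
      by (simp only: assms(8) eqs a_def q_def)
    also have "\<dots> = - (c * a\<^sup>2 * (1 + a\<^sup>2 * (q - 1)))"
      by (simp add: c_def)
    also have "\<dots> = c * a\<^sup>2 * (a\<^sup>2 * (1 - q) - 1)"
      by (simp add: algebra_simps)
    finally show ?thesis .
  qed
  have sign: "(H \<ge> 0 \<longleftrightarrow> q \<le> 1 - 1 / a\<^sup>2) \<and> (H = 0 \<longleftrightarrow> q = 1 - 1 / a\<^sup>2) \<and> (H \<le> 0 \<longleftrightarrow> q \<ge> 1 - 1 / a\<^sup>2)"
    if "F z0 \<noteq> 0" "F' z0 \<noteq> 0"
  proof -
    have a0: "a > 0" using that by (simp add: a_def)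
    define k where "k = c * a\<^sup>2 * a\<^sup>2"
    have k: "k > 0" using a0 c that by (simp add: k_def)
    have "H = k * ((1 - 1 / a\<^sup>2) - q)"
      using a0 by (simp add: H[OF that(1)] k_def field_simps)
    then show ?thesis
      using k by (simp add: zero_le_mult_iff mult_le_0_iff) linarith
  qed
  \<comment> \<open>With \<open>F'' = 0\<close> the term \<open>q\<close> disappears, so \<open>H\<close> has the sign of \<open>a\<^sup>2 - 1\<close>.\<close>
  have sign2: "(a > 1 \<longrightarrow> H > 0) \<and> (a < 1 \<longrightarrow> H < 0)"
    if nz: "F z0 \<noteq> 0" "F' z0 \<noteq> 0" and F'': "F'' z0 = 0"
  proof -
    have a0: "a > 0" using nz by (simp add: a_def)
    then have k: "c * a\<^sup>2 > 0" using c nz by simp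
    have "q = 0" by (simp add: q_def F'')
    then have Hq: "H = c * a\<^sup>2 * (a\<^sup>2 - 1)" using H nz by simp
    have "a\<^sup>2 - 1 > 0" if "a > 1" using that by (simp add: power2_eq_square less_1_mult)
    moreover have "a\<^sup>2 - 1 < 0" if "a < 1"
      using that a0 power_Suc_less_one[of a 1] by (simp add: power2_eq_square)
    ultimately show ?thesis
      unfolding Hq using k by (auto intro: mult_pos_pos mult_pos_neg)
  qed
  have flat: "H = 0" if "F z0 \<noteq> 0" "F' z0 = 0"
    using H that by (simp add: a_def)
  have simple: "\<not> h differentiable (at z0)" if "F z0 = 0" "F' z0 \<noteq> 0"
    using not_differentiable_at_simple_zero[OF holomorphic_derivI[OF hol assms(1,4)]] that
    by (simp add: eqs)
  have nondef: "\<not> lorentz_mean_curvature_defined h z0" if "\<not> h differentiable (at z0)"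
    using that unfolding lorentz_mean_curvature_defined_def C2_near_def
    by (metis differentiable_on_eq_differentiable_at)
  have triple: "lorentz_mean_curvature_defined h z0 \<and> H = 0"
    if "F z0 = 0" "F' z0 = 0" "F'' z0 = 0"
    using lorentz_mean_curvature_defined_triple_zero[OF hol assms(1,4)]
      lorentz_mean_curvature_triple_zero[OF hol assms(1,4)] that
    by (simp add: eqs assms(8))
  show ?thesis
    using defd sign sign2 flat simple nondef triple unfolding a_def q_def by blast
qed

end
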